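(* Each of the tensors in $\mathbb{C}^5\otimes\mathbb{C}^5\otimes\mathbb{C}^5$ corresponding to the linear spaces spanned by the identity matrix and one of the following $4$-dimensional subspaces of $5\times5$ matrices ($a,b,d,e\in\mathbb{C}$) has border rank $5$: $$S_1=\begin{pmatrix}0&0&0&0&0\\ 0&0&0&0&0\\ a&0&0&0&0\\ d&0&0&0&0\\ b&e&a&0&0\end{pmatrix},\quad S_2=\begin{pmatrix}0&0&0&0&0\\ 0&0&0&0&0\\ a&0&0&0&0\\ d&a&0&0&0\\ b&e&a&0&0\end{pmatrix},\quad S_3=\begin{pmatrix}0&0&0&0&0\\ 0&0&0&0&0\\ a&0&0&0&0\\ d&e&0&0&0\\ b&0&a&0&0\end{pmatrix},\quad S_4=\begin{pmatrix}0&0&0&0&0\\ 0&0&0&0&0\\ a&0&0&0&0\\ d&e&0&0&0\\ b&d&a&0&0\end{pmatrix}.$$ The tensors corresponding to $S_1,S_3,S_4$ have rank $9$ and the tensor corresponding to $S_2$ has rank $10$.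
   Context: All vector spaces are over $\mathbb{C}$. To a $5$-dimensional linear subspace $U$ of $5\times5$ matrices (identified with $\mathbb{C}^5\otimes\mathbb{C}^5$) one associates the tensor $T=\sum_{i=1}^5a_i\otimes M_i\in\mathbb{C}^5\otimes\mathbb{C}^5\otimes\mathbb{C}^5$, where $\{M_i\}$ is a basis of $U$ and $\{a_i\}$ a basis of the first factor (well defined up to change of basis in the first factor). Rank: least $r$ such that $T$ is a sum of $r$ tensors $u\otimes v\otimes w$. Border rank: least $r$ such that $T$ is a limit of tensors of rank $r$. *)

theory Defs
  imports "HOL-Analysis.Analysis"
begin

text \<open>
  Indices run over the numeral type \<open>5\<close>, whose elements are written \<open>1, 2, 3, 4, 5\<close> (with
  \<open>5 = 0\<close>).  A \<open>5 \<times> 5\<close> matrix is an element of \<^typ>\<open>complex^5^5\<close>, the first index being the row;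
  a tensor in the triple tensor power of \<open>\<complex>\<^sup>5\<close> is its coordinate array
  \<open>T $ i $ j $ k\<close> of type \<^typ>\<open>complex^5^5^5\<close>.
\<close>

text \<open>
  The library only provides scalar multiplication \<open>(*s)\<close> for vectors over a field; on matrices
  \<open>(*s)\<close> would multiply rows componentwise.
\<close>

definition mat_scale :: "'a::field \<Rightarrow> 'a^'n^'m \<Rightarrow> 'a^'n^'m" where
  "mat_scale c A = (\<chi> i j. c * A $ i $ j)"

interpretation matsp: vector_space mat_scale
  by unfold_locales (simp_all add: mat_scale_def vec_eq_iff algebra_simps)

definition tensor3 :: "'a::field^'i \<Rightarrow> 'a^'m \<Rightarrow> 'a^'n \<Rightarrow> 'a^'n^'m^'i" where
  "tensor3 u v w = (\<chi> i j k. u $ i * v $ j * w $ k)"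

text \<open>\<open>u \<otimes> A\<close>, where the matrix \<open>A\<close> is identified with \<open>\<Sum>j k. A $ j $ k (e\<^sub>j \<otimes> e\<^sub>k)\<close>.\<close>

definition tensor_mat :: "'a::field^'i \<Rightarrow> 'a^'n^'m \<Rightarrow> 'a^'n^'m^'i" where
  "tensor_mat u A = (\<chi> i j k. u $ i * A $ j $ k)"

definition tensor_rank :: "'a::field^'n^'m^'i \<Rightarrow> nat" where
  "tensor_rank T = (LEAST r. \<exists>u v w. T = (\<Sum>l<r. tensor3 (u l) (v l) (w l)))"

definition border_rank :: "complex^'n^'m^'i \<Rightarrow> nat" where
  "border_rank T = (LEAST r. \<exists>X. (\<forall>n. tensor_rank (X n) = r) \<and> X \<longlonglongrightarrow> T)"

text \<open>
  All tensors associated with a linear space \<open>U\<close> of matrices, one for each choice of a basis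
  of \<open>U\<close> and of a basis of the first factor.  Bases are indexed families, so the set is empty
  unless \<open>dim U\<close> equals the dimension of the first factor.
\<close>

definition space_tensors :: "('a::field^'n^'m) set \<Rightarrow> ('a^'n^'m^'i) set" where
  "space_tensors U = {\<Sum>i\<in>UNIV. tensor_mat (a i) (M i) | (a :: 'i \<Rightarrow> 'a^'i) M.
     inj a \<and> vec.independent (range a) \<and> vec.span (range a) = UNIV \<and>
     inj M \<and> matsp.independent (range M) \<and> matsp.span (range M) = U}"

definition S1 :: "(complex^5^5) set" where
  "S1 = {vector [vector [0, 0, 0, 0, 0],
                 vector [0, 0, 0, 0, 0],
                 vector [a, 0, 0, 0, 0],
                 vector [d, 0, 0, 0, 0],
                 vector [b, e, a, 0, 0]] | a b d e. True}"

definition S2 :: "(complex^5^5) set" where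
  "S2 = {vector [vector [0, 0, 0, 0, 0],
                 vector [0, 0, 0, 0, 0],
                 vector [a, 0, 0, 0, 0],
                 vector [d, a, 0, 0, 0],
                 vector [b, e, a, 0, 0]] | a b d e. True}"

definition S3 :: "(complex^5^5) set" where
  "S3 = {vector [vector [0, 0, 0, 0, 0],
                 vector [0, 0, 0, 0, 0],
                 vector [a, 0, 0, 0, 0],
                 vector [d, e, 0, 0, 0],
                 vector [b, 0, a, 0, 0]] | a b d e. True}"

definition S4 :: "(complex^5^5) set" where
  "S4 = {vector [vector [0, 0, 0, 0, 0],
                 vector [0, 0, 0, 0, 0],
                 vector [a, 0, 0, 0, 0],
                 vector [d, e, 0, 0, 0],
                 vector [b, d, a, 0, 0]] | a b d e. True}"

definition with_identity :: "(complex^5^5) set \<Rightarrow> (complex^5^5) set" where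
  "with_identity S = matsp.span (insert (mat 1) S)"

lemma exhaust_5: "x = 1 \<or> x = 2 \<or> x = 3 \<or> x = 4 \<or> x = 5" for x :: 5
proof (induct x)
  case (of_int z)
  hence "z = 0 \<or> z = 1 \<or> z = 2 \<or> z = 3 \<or> z = 4" by simp presburger
  moreover have "(of_int 0::5) = 5" by simp
  ultimately show ?case by (elim disjE) simp_all
qed

lemma UNIV_5: "(UNIV :: 5 set) = {1, 2, 3, 4, 5}"
  using exhaust_5 by blast

lemma forall_5: "(\<forall>i::5. P i) \<longleftrightarrow> P 1 \<and> P 2 \<and> P 3 \<and> P 4 \<and> P 5"
  by (metis exhaust_5)

lemma sum_5: "sum f (UNIV :: 5 set) = f 1 + f 2 + f 3 + f 4 + f 5"
  unfolding UNIV_5 by (simp add: add.assoc)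

lemma vector_5 [simp]:
  "(vector [p, q, r, s, t] :: 'a::zero^5) $ 1 = p"
  "(vector [p, q, r, s, t] :: 'a::zero^5) $ 2 = q"
  "(vector [p, q, r, s, t] :: 'a::zero^5) $ 3 = r"
  "(vector [p, q, r, s, t] :: 'a::zero^5) $ 4 = s"
  "(vector [p, q, r, s, t] :: 'a::zero^5) $ 5 = t"
  unfolding vector_def by simp_all

lemma independent_family:
  assumes "\<And>c. (\<Sum>i\<in>UNIV. mat_scale (c i) (M i)) = 0 \<Longrightarrow> \<forall>i. c i = 0"
  shows "inj M" "matsp.independent (range (M :: 'i::finite \<Rightarrow> 'a::field^'n^'m))"
proof -
  show inj: "inj M"
  proof (rule injI, rule ccontr)
    fix i j assume ij: "M i = M j" "i \<noteq> j"
    let ?c = "\<lambda>k. if k = i then 1 else if k = j then - 1 else (0::'a)"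
    have "(\<Sum>k\<in>UNIV. mat_scale (?c k) (M k)) = (\<Sum>k\<in>{i, j}. mat_scale (?c k) (M k))"
      by (rule sum.mono_neutral_right) auto
    also have "\<dots> = 0" using ij by simp
    finally have "\<forall>k. ?c k = 0" by (rule assms)
    then have "?c i = 0" by blast
    then show False by simp
  qed
  show "matsp.independent (range M)"
  proof (rule matsp.independent_if_scalars_zero)
    show "finite (range M)" by simp
    fix f x assume "(\<Sum>x\<in>range M. mat_scale (f x) x) = 0" and "x \<in> range M"
    then show "f x = 0"
      using assms[of "\<lambda>i. f (M i)"] by (auto simp: sum.reindex[OF inj])
  qed
qed

lemma space_tensors_nonempty:
  fixes M :: "'i::finite \<Rightarrow> 'a::field^'n^'m"
  assumes "\<And>c. (\<Sum>i\<in>UNIV. mat_scale (c i) (M i)) = 0 \<Longrightarrow> \<forall>i. c i = 0"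
  shows "(space_tensors (matsp.span (range M)) :: ('a^'n^'m^'i) set) \<noteq> {}"
proof -
  have "range (\<lambda>i. axis i 1 :: 'a^'i) = cart_basis"
    by (auto simp: cart_basis_def)
  moreover have "inj (\<lambda>i. axis i 1 :: 'a^'i)"
    by (auto simp: inj_def axis_eq_axis)
  ultimately have "(\<Sum>i\<in>UNIV. tensor_mat (axis i 1) (M i)) \<in>
      (space_tensors (matsp.span (range M)) :: ('a^'n^'m^'i) set)"
    unfolding space_tensors_def mem_Collect_eq
    using independent_family(1)[of M, OF assms] independent_family(2)[of M, OF assms]
      independent_cart_basis span_cart_basis
    by (intro exI[of _ "\<lambda>i. axis i 1"] exI[of _ M]) simp
  then show ?thesis by blast
qed

lemma with_identity_nonempty:
  fixes A :: "complex \<Rightarrow> complex \<Rightarrow> complex \<Rightarrow> complex \<Rightarrow> complex^5^5"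
  assumes lin: "\<And>a b d e. A a b d e = mat_scale a (A 1 0 0 0) + mat_scale b (A 0 1 0 0) +
      mat_scale d (A 0 0 1 0) + mat_scale e (A 0 0 0 1)"
    and indep: "\<And>x a b d e. mat_scale x (mat 1) + A a b d e = 0 \<Longrightarrow> x = 0 \<and> a = 0 \<and> b = 0 \<and> d = 0 \<and> e = 0"
  shows "(space_tensors (with_identity {A a b d e | a b d e. True}) :: (complex^5^5^5) set) \<noteq> {}"
proof -
  let ?S = "{A a b d e | a b d e. True}"
  define M :: "5 \<Rightarrow> complex^5^5" where
    "M i = vector [mat 1, A 1 0 0 0, A 0 1 0 0, A 0 0 1 0, A 0 0 0 1] $ i" for i
  have M: "M 1 = mat 1" "M 2 = A 1 0 0 0" "M 3 = A 0 1 0 0" "M 4 = A 0 0 1 0" "M 5 = A 0 0 0 1"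
    unfolding M_def by (rule vector_5)+
  have rng: "range M = {mat 1, A 1 0 0 0, A 0 1 0 0, A 0 0 1 0, A 0 0 0 1}"
    unfolding UNIV_5 by (simp only: image_insert image_empty M)
  have "matsp.span (range M) = matsp.span (insert (mat 1) ?S)"
  proof (rule matsp.span_eq[THEN iffD2], intro conjI)
    show "range M \<subseteq> matsp.span (insert (mat 1) ?S)"
      unfolding rng by (intro subset_trans[OF _ matsp.span_superset]) blast
    have "A a b d e \<in> matsp.span (range M)" for a b d e
      unfolding lin[of a b d e] rng
      by (intro matsp.span_add matsp.span_scale matsp.span_base) simp_all
    moreover have "mat 1 \<in> matsp.span (range M)"
      unfolding rng by (rule matsp.span_base) simp
    ultimately show "insert (mat 1) ?S \<subseteq> matsp.span (range M)" by blast
  qed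
  moreover have "\<forall>i. c i = 0" if "(\<Sum>i\<in>UNIV. mat_scale (c i) (M i)) = 0" for c
  proof -
    have "mat_scale (c 1) (mat 1) + A (c 2) (c 3) (c 4) (c 5) = 0"
      using that unfolding sum_5 M lin[of "c 2" "c 3" "c 4" "c 5"] by (simp only: add.assoc)
    from indep[OF this] show ?thesis unfolding forall_5 by blast
  qed
  ultimately show ?thesis
    unfolding with_identity_def using space_tensors_nonempty[of M] by simp
qed

text \<open>Each of the four spaces spanned by the identity and \<open>S\<^sub>i\<close> is \<open>5\<close>-dimensional, so it has associated tensors.\<close>

lemma space_tensors_S_nonempty:
  "(space_tensors (with_identity S1) :: (complex^5^5^5) set) \<noteq> {}"
  "(space_tensors (with_identity S2) :: (complex^5^5^5) set) \<noteq> {}"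
  "(space_tensors (with_identity S3) :: (complex^5^5^5) set) \<noteq> {}"
  "(space_tensors (with_identity S4) :: (complex^5^5^5) set) \<noteq> {}"
  unfolding S1_def S2_def S3_def S4_def
  by (rule with_identity_nonempty;
      simp add: vec_eq_iff forall_5 mat_scale_def mat_def)+

end

theory Submission
  imports Defs
begin

text \<open>
  Write a tensor of the space as \<open>x I + a N + b E\<^sub>5\<^sub>1 + d D + e E\<close>.

  Lower bound for the rank, by the substitution method: a decomposition loses one term whenever a
  slice, row or column with a nonzero entry is used to eliminate itself from all the others.  The
  slice \<open>I\<close> allows the elimination of rows 1, 2 and columns 3, 4, 5.  None of these affects
  the relevant entries of the other four slices, whose \<open>3 \<times> 2\<close> blocks are still linearly
  independent, so four more terms are lost.  For \<open>S\<^sub>2\<close> the last remaining slice has rank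
  2, which costs yet another term.

  Upper bound for the rank: modulo three matrices of rank one that span \<open>b, d, e\<close> one has to
  decompose the pencil \<open>x I + a N\<close>, and \<open>N\<close> becomes diagonalizable with eigenvalues
  \<open>0, 1, -1\<close> on adding one matrix of rank one per Jordan block.

  Border rank: the space is a limit of spaces of simultaneously diagonalizable matrices.  One
  deforms two of the rank one matrices to multiples of idempotents \<open>v\<^sub>i w\<^sub>i\<^sup>T\<close>
  with \<open>w\<^sub>i\<^sup>T v\<^sub>j = 0\<close> for \<open>i \<noteq> j\<close>, and \<open>N\<close> to a matrix
  \<open>N\<^sub>t\<close> with \<open>N\<^sub>t v\<^sub>i = 0\<close>,
  \<open>w\<^sub>i\<^sup>T N\<^sub>t = 0\<close> and distinct eigenvalues on the complement; then
  \<open>N\<^sub>t\<^sup>2\<close> tends to \<open>E\<^sub>5\<^sub>1\<close>.  No fewer terms suffice, since the identity is a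
  combination of slices and the determinant is continuous.
\<close>

section \<open>Decompositions into \<open>r\<close> product tensors\<close>

definition rank_le :: "nat \<Rightarrow> 'a::field^'n^'m^'i \<Rightarrow> bool" where
  "rank_le r T \<longleftrightarrow> (\<exists>u v w. T = (\<Sum>l<r. tensor3 (u l) (v l) (w l)))"

lemma rank_le_iff:
  "rank_le r T \<longleftrightarrow> (\<exists>u v w. \<forall>i j k. T $ i $ j $ k = (\<Sum>l<r. u l i * v l j * w l k))"
  (is "?L \<longleftrightarrow> ?R")
proof
  assume ?L
  then obtain u v w where "T = (\<Sum>l<r. tensor3 (u l) (v l) (w l))"
    unfolding rank_le_def by blast
  then show ?R
    by (intro exI[of _ "\<lambda>l. ($) (u l)"] exI[of _ "\<lambda>l. ($) (v l)"] exI[of _ "\<lambda>l. ($) (w l)"])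
      (simp add: tensor3_def)
next
  assume ?R
  then obtain u v w where "\<forall>i j k. T $ i $ j $ k = (\<Sum>l<r. u l i * v l j * w l k)" by blast
  then show ?L
    unfolding rank_le_def
    by (intro exI[of _ "\<lambda>l. vec_lambda (u l)"] exI[of _ "\<lambda>l. vec_lambda (v l)"]
        exI[of _ "\<lambda>l. vec_lambda (w l)"]) (simp add: vec_eq_iff tensor3_def)
qed

lemma rank_le_0: "rank_le 0 (0 :: 'a::field^'n^'m^'i)"
  by (simp add: rank_le_def)

lemma rank_le_Suc:
  assumes "rank_le r T"
  shows "rank_le (Suc r) (T + tensor3 x y z)"
proof -
  obtain u v w where "T = (\<Sum>l<r. tensor3 (u l) (v l) (w l))"
    using assms unfolding rank_le_def by blast
  then have "T + tensor3 x y z =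
      (\<Sum>l<Suc r. tensor3 ((u(r := x)) l) ((v(r := y)) l) ((w(r := z)) l))"
    by simp
  then show ?thesis unfolding rank_le_def by blast
qed

text \<open>Guarantees that the \<open>LEAST\<close> in \<open>tensor_rank\<close> is attained:
  attaching each row \<open>T $ i $ j\<close> to the pair of standard basis vectors i, j gives a
  finite decomposition.\<close>

lemma rank_le_exists:
  fixes T :: "'a::field^'n^'m^'i"
  shows "\<exists>r. rank_le r T"
proof -
  have *: "\<exists>r. rank_le r (\<Sum>x\<in>A. tensor3 (f x) (g x) (h x))" if "finite A"
    for A :: "('i \<times> 'm) set" and f g and h :: "_ \<Rightarrow> 'a^'n"
    using that
  proof induction
    case empty
    then show ?case using rank_le_0 by auto
  next
    case (insert x A)
    then obtain r where "rank_le r (\<Sum>x\<in>A. tensor3 (f x) (g x) (h x))" by blast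
    from rank_le_Suc[OF this, of "f x" "g x" "h x"] insert.hyps show ?case
      by (auto simp: add.commute)
  qed
  have eq: "(\<Sum>x\<in>UNIV. tensor3 (axis (fst x) 1) (axis (snd x) 1) (T $ fst x $ snd x)) = T"
  proof -
    have "(\<Sum>x\<in>UNIV. axis (fst x) 1 $ i * axis (snd x) 1 $ j * T $ fst x $ snd x $ k) = T $ i $ j $ k"
      for i j k
    proof -
      have "(\<Sum>x\<in>UNIV. axis (fst x) 1 $ i * axis (snd x) 1 $ j * T $ fst x $ snd x $ k)
        = (\<Sum>x\<in>UNIV. if x = (i, j) then T $ i $ j $ k else 0)"
        by (rule sum.cong) (auto simp: axis_def prod_eq_iff)
      then show ?thesis by simp
    qed
    then show ?thesis by (simp add: vec_eq_iff tensor3_def)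
  qed
  have "\<exists>r. rank_le r (\<Sum>x\<in>UNIV. tensor3 (axis (fst x) 1) (axis (snd x) 1) (T $ fst x $ snd x))"
    by (rule *) simp
  then show ?thesis unfolding eq .
qed

lemma rank_le_tensor_rank: "rank_le (tensor_rank T) T"
  using rank_le_exists[of T] unfolding tensor_rank_def rank_le_def by (rule LeastI_ex)

lemma tensor_rank_eqI:
  assumes "rank_le r T" "\<And>s. rank_le s T \<Longrightarrow> r \<le> s"
  shows "tensor_rank T = r"
  using assms unfolding tensor_rank_def rank_le_def[symmetric] by (rule Least_equality)

section \<open>The substitution method\<close>

text \<open>A nonzero entry in slice \<open>p\<close> forces some term with \<open>u l p\<close>
  nonzero. Subtracting \<open>u l i / u l p\<close> times slice \<open>p\<close> from every slice
  \<open>i\<close> cancels exactly that term.\<close>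

lemma rank_le_eliminate_slice:
  assumes "rank_le r T" "T $ p $ q $ s \<noteq> 0"
  obtains r' T' c where "r = Suc r'" "rank_le r' T'"
    "\<And>i j k. T' $ i $ j $ k = T $ i $ j $ k - c i * T $ p $ j $ k"
proof -
  obtain u v w where T: "\<And>i j k. T $ i $ j $ k = (\<Sum>l<r. u l i * v l j * w l k)"
    using assms(1) unfolding rank_le_iff by blast
  obtain l where l: "l < r" "u l p \<noteq> 0"
  proof (rule ccontr)
    assume "\<not> thesis"
    then have "\<forall>l<r. u l p = 0" using that by blast
    then show False using assms(2) T by simp
  qed
  obtain r' where r: "r = Suc r'" using l by (cases r) auto
  \<comment> \<open>the remaining terms are reindexed by moving the last one into the vacated place\<close>
  define \<sigma> where "\<sigma> m = (if m = l then r' else m)" for m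
  define c where "c i = u l i / u l p" for i
  define u' where "u' m i = u (\<sigma> m) i - c i * u (\<sigma> m) p" for m i
  have bij: "bij_betw \<sigma> {..<r'} ({..<r} - {l})"
    using l r by (intro bij_betwI[of _ _ _ "\<lambda>m. if m = r' then l else m"]) (auto simp: \<sigma>_def)
  have "T $ i $ j $ k - c i * T $ p $ j $ k = (\<Sum>m<r'. u' m i * v (\<sigma> m) j * w (\<sigma> m) k)" for i j k
  proof -
    have "T $ i $ j $ k - c i * T $ p $ j $ k
        = (\<Sum>m<r. (u m i - c i * u m p) * v m j * w m k)"
      by (simp add: T sum_distrib_left sum_subtractf algebra_simps)
    also have "\<dots> = (\<Sum>m\<in>{..<r} - {l}. (u m i - c i * u m p) * v m j * w m k)"
      using l by (intro sum.mono_neutral_right) (auto simp: c_def)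
    also have "\<dots> = (\<Sum>m<r'. u' m i * v (\<sigma> m) j * w (\<sigma> m) k)"
      unfolding u'_def by (rule sum.reindex_bij_betw[OF bij, symmetric])
    finally show ?thesis .
  qed
  then have "rank_le r' (\<chi> i j k. T $ i $ j $ k - c i * T $ p $ j $ k)"
    unfolding rank_le_iff
    by (intro exI[of _ u'] exI[of _ "\<lambda>m. v (\<sigma> m)"] exI[of _ "\<lambda>m. w (\<sigma> m)"]) simp
  then show thesis by (rule that[OF r, of _ c]) simp
qed

text \<open>Cyclic shift of the three factors. Its third power is the identity, so eliminating a row
  or a column reduces to eliminating a slice of a rotated tensor and rotating back.\<close>

lemma rank_le_rotate:
  assumes "rank_le r T"
  shows "rank_le r (\<chi> j k i. T $ i $ j $ k)"
proof -
  obtain u v w where "\<forall>i j k. T $ i $ j $ k = (\<Sum>l<r. u l i * v l j * w l k)"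
    using assms unfolding rank_le_iff by blast
  then show ?thesis unfolding rank_le_iff
    by (intro exI[of _ v] exI[of _ w] exI[of _ u]) (simp add: mult_ac)
qed

lemma rank_le_eliminate_row:
  assumes "rank_le r T" "T $ p $ q $ s \<noteq> 0"
  obtains r' T' c where "r = Suc r'" "rank_le r' T'"
    "\<And>i j k. T' $ i $ j $ k = T $ i $ j $ k - c j * T $ i $ q $ k"
proof -
  obtain r' T' c where T': "r = Suc r'" "rank_le r' T'"
    "\<And>j k i. T' $ j $ k $ i = T $ i $ j $ k - c j * T $ i $ q $ k"
    using rank_le_eliminate_slice[OF rank_le_rotate[OF assms(1)], of q s p] assms(2) by auto
  show thesis
    by (rule that[OF T'(1) rank_le_rotate[OF rank_le_rotate[OF T'(2)]], of c]) (simp add: T'(3))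
qed

lemma rank_le_eliminate_column:
  assumes "rank_le r T" "T $ p $ q $ s \<noteq> 0"
  obtains r' T' c where "r = Suc r'" "rank_le r' T'"
    "\<And>i j k. T' $ i $ j $ k = T $ i $ j $ k - c k * T $ i $ j $ s"
proof -
  obtain r' T' c where T': "r = Suc r'" "rank_le r' T'"
    "\<And>j k i. T' $ j $ k $ i = T $ i $ j $ k - c k * T $ i $ j $ s"
    using rank_le_eliminate_row[OF rank_le_rotate[OF assms(1)], of q s p] assms(2) by auto
  show thesis
    by (rule that[OF T'(1) rank_le_rotate[OF rank_le_rotate[OF T'(2)]], of c]) (simp add: T'(3))
qed

section \<open>Lower bounds for the rank\<close>

text \<open>One family for all four spaces, which differ only in the entries (4,2) and (5,2): the
  parameters 0 0 1 0, 1 0 1 0, 0 1 0 0 and 0 1 0 1 give \<open>S1\<close>, \<open>S2\<close>,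
  \<open>S3\<close> and \<open>S4\<close>.\<close>

definition pattern ::
  "complex \<Rightarrow> complex \<Rightarrow> complex \<Rightarrow> complex \<Rightarrow> complex \<Rightarrow> complex \<Rightarrow> complex \<Rightarrow> complex \<Rightarrow>
     complex^5^5" where
  "pattern p q s t a b d e = vector [vector [0, 0, 0, 0, 0],
                 vector [0, 0, 0, 0, 0],
                 vector [a, 0, 0, 0, 0],
                 vector [d, p * a + q * e, 0, 0, 0],
                 vector [b, s * e + t * d, a, 0, 0]]"

definition pattern_tensor :: "complex \<Rightarrow> complex \<Rightarrow> complex \<Rightarrow> complex \<Rightarrow> complex^5^5^5" where
  "pattern_tensor p q s t = vector [mat 1, pattern p q s t 1 0 0 0, pattern p q s t 0 1 0 0,
     pattern p q s t 0 0 1 0, pattern p q s t 0 0 0 1]"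

text \<open>The pivots are the diagonal entries of the identity, each still 1 when its turn comes.
  In the other slices rows 1, 2 and columns 4, 5 vanish, while column 3 may not, so the only trace
  left there is a multiple of column 3.\<close>

lemma pattern_tensor_eliminate_identity:
  assumes "rank_le r (pattern_tensor p q s t)"
  obtains r' H \<mu> where "r = r' + 5" "rank_le r' H"
    "\<And>i j k. i \<noteq> 1 \<Longrightarrow> H $ i $ j $ k =
      pattern_tensor p q s t $ i $ j $ k - \<mu> k * pattern_tensor p q s t $ i $ j $ 3"
proof -
  let ?B = "pattern_tensor p q s t"
  have id: "?B $ 1 $ j $ k = (if j = k then 1 else 0)" for j k
    by (simp add: pattern_tensor_def mat_def)
  have z: "?B $ i $ 1 $ k = 0" "?B $ i $ 2 $ k = 0" "?B $ i $ k $ 4 = 0" "?B $ i $ k $ 5 = 0"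
    if "i \<noteq> 1" for i k
    using exhaust_5[of i] exhaust_5[of k] that by (auto simp: pattern_tensor_def pattern_def)
  obtain r1 T1 a1 where T1: "r = Suc r1" "rank_le r1 T1"
    "\<And>i j k. T1 $ i $ j $ k = ?B $ i $ j $ k - a1 j * ?B $ i $ 1 $ k"
    using rank_le_eliminate_row[OF assms, of 1 1 1] id by auto
  obtain r2 T2 a2 where T2: "r1 = Suc r2" "rank_le r2 T2"
    "\<And>i j k. T2 $ i $ j $ k = T1 $ i $ j $ k - a2 j * T1 $ i $ 2 $ k"
    using rank_le_eliminate_row[OF T1(2), of 1 2 2] id T1(3) by auto
  obtain r3 T3 a3 where T3: "r2 = Suc r3" "rank_le r3 T3"
    "\<And>i j k. T3 $ i $ j $ k = T2 $ i $ j $ k - a3 k * T2 $ i $ j $ 3"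
    using rank_le_eliminate_column[OF T2(2), of 1 3 3] id T1(3) T2(3) by auto
  obtain r4 T4 a4 where T4: "r3 = Suc r4" "rank_le r4 T4"
    "\<And>i j k. T4 $ i $ j $ k = T3 $ i $ j $ k - a4 k * T3 $ i $ j $ 4"
    using rank_le_eliminate_column[OF T3(2), of 1 4 4] id T1(3) T2(3) T3(3) by auto
  obtain r5 T5 a5 where T5: "r4 = Suc r5" "rank_le r5 T5"
    "\<And>i j k. T5 $ i $ j $ k = T4 $ i $ j $ k - a5 k * T4 $ i $ j $ 5"
    using rank_le_eliminate_column[OF T4(2), of 1 5 5] id T1(3) T2(3) T3(3) T4(3) by auto
  have "r = r5 + 5" using T1 T2 T3 T4 T5 by simp
  \<comment> \<open>Eliminating column 3 turns the zero columns 4 and 5 into multiples of column 3,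
    so the two later eliminations change the multiplier again.\<close>
  show thesis
    by (rule that[OF \<open>r = r5 + 5\<close> T5(2),
          of "\<lambda>k. a3 k - a4 k * a3 4 - a5 k * (a3 5 - a4 5 * a3 4)"])
      (simp add: T1(3) T2(3) T3(3) T4(3) T5(3) z algebra_simps)
qed

text \<open>Three further pivots, in this order: (5,1) in slice 3, then \<open>q\<close> at (4,2) or
  \<open>s\<close> at (5,2) in slice 5, then (4,1) in slice 4. These slices are zero in row 3, so
  row 3 of slice 2 survives; if \<open>q = 0\<close> they also vanish at (4,2), which preserves
  \<open>p\<close>.\<close>

lemma rank_le_pattern_tensor_eliminate:
  assumes "rank_le r (pattern_tensor p q s t)" "q \<noteq> 0 \<or> s \<noteq> 0"
  obtains r' and T :: "complex^5^5^5" where "r = r' + 8" "rank_le r' T"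
    "T $ 2 $ 3 $ 1 = 1" "T $ 2 $ 3 $ 2 = 0" "q = 0 \<Longrightarrow> t = 0 \<Longrightarrow> T $ 2 $ 4 $ 2 = p"
proof -
  obtain r0 H m where H: "r = r0 + 5" "rank_le r0 H"
    "\<And>i j k. i \<noteq> 1 \<Longrightarrow> H $ i $ j $ k =
      pattern_tensor p q s t $ i $ j $ k - m k * pattern_tensor p q s t $ i $ j $ 3"
    using pattern_tensor_eliminate_identity[OF assms(1)] by metis
  note B = H(3) pattern_tensor_def pattern_def
  obtain r1 T1 a1 where T1: "r0 = Suc r1" "rank_le r1 T1"
    "\<And>i j k. T1 $ i $ j $ k = H $ i $ j $ k - a1 i * H $ 3 $ j $ k"
    using rank_le_eliminate_slice[OF H(2), of 3 5 1] by (auto simp: B)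
  have "T1 $ 5 $ 4 $ 2 \<noteq> 0 \<or> T1 $ 5 $ 5 $ 2 \<noteq> 0"
    using assms(2) by (auto simp: T1(3) B)
  then obtain r2 T2 a2 where T2: "r1 = Suc r2" "rank_le r2 T2"
    "\<And>i j k. T2 $ i $ j $ k = T1 $ i $ j $ k - a2 i * T1 $ 5 $ j $ k"
    using rank_le_eliminate_slice[OF T1(2), of 5] by metis
  obtain r3 T3 a3 where T3: "r2 = Suc r3" "rank_le r3 T3"
    "\<And>i j k. T3 $ i $ j $ k = T2 $ i $ j $ k - a3 i * T2 $ 4 $ j $ k"
    using rank_le_eliminate_slice[OF T2(2), of 4 4 1] by (auto simp: T1(3) T2(3) B)
  show thesis
    by (rule that[OF _ T3(2)]) (use H(1) T1(1) T2(1) T3(1) in \<open>auto simp: T3(3) T2(3) T1(3) B\<close>)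
qed

lemma rank_le_pattern_tensor_ge_9:
  assumes "rank_le r (pattern_tensor p q s t)" "q \<noteq> 0 \<or> s \<noteq> 0"
  shows "9 \<le> r"
proof -
  obtain r' and T :: "complex^5^5^5" where T: "r = r' + 8" "rank_le r' T" "T $ 2 $ 3 $ 1 = 1"
    using rank_le_pattern_tensor_eliminate[OF assms] by metis
  obtain r1 T1 c where "r' = Suc r1" "rank_le r1 T1"
    "\<And>i j k. T1 $ i $ j $ k = T $ i $ j $ k - c i * T $ 2 $ j $ k"
    using rank_le_eliminate_slice[OF T(2), of 2 3 1] T(3) by auto
  then show ?thesis using T(1) by simp
qed

text \<open>In columns 1 and 2 the last slice has row 3 equal to (1, 0) and \<open>p\<close> at
  (4,2). Eliminating row 3 therefore leaves \<open>p\<close> in place, and this nonzero entry costs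
  a tenth term.\<close>

lemma rank_le_pattern_tensor_ge_10:
  assumes "rank_le r (pattern_tensor p 0 s 0)" "s \<noteq> 0" "p \<noteq> 0"
  shows "10 \<le> r"
proof -
  obtain r' and T :: "complex^5^5^5" where T: "r = r' + 8" "rank_le r' T" "T $ 2 $ 3 $ 1 = 1"
    "T $ 2 $ 3 $ 2 = 0" "T $ 2 $ 4 $ 2 = p"
    using rank_le_pattern_tensor_eliminate[OF assms(1)] assms(2) by metis
  obtain r1 T1 c where T1: "r' = Suc r1" "rank_le r1 T1"
    "\<And>i j k. T1 $ i $ j $ k = T $ i $ j $ k - c j * T $ i $ 3 $ k"
    using rank_le_eliminate_row[OF T(2), of 2 3 1] T(3) by auto
  have "T1 $ 2 $ 4 $ 2 \<noteq> 0" using T assms(3) by (simp add: T1(3))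
  then obtain r2 where "r1 = Suc r2"
    using rank_le_eliminate_row[OF T1(2)] by metis
  then show ?thesis using T(1) T1(1) by simp
qed

section \<open>Independence of the chosen bases\<close>

definition change_basis :: "'a::field^'p^'i \<Rightarrow> 'a^'n^'m^'p \<Rightarrow> 'a^'n^'m^'i" where
  "change_basis g T = (\<chi> i j k. \<Sum>p\<in>UNIV. g $ i $ p * T $ p $ j $ k)"

lemma rank_le_change_basis:
  assumes "rank_le r T"
  shows "rank_le r (change_basis g T)"
proof -
  obtain u v w where T: "\<And>i j k. T $ i $ j $ k = (\<Sum>l<r. u l i * v l j * w l k)"
    using assms unfolding rank_le_iff by blast
  have "change_basis g T $ i $ j $ k = (\<Sum>l<r. (\<Sum>p\<in>UNIV. g $ i $ p * u l p) * v l j * w l k)" for i j k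
    unfolding change_basis_def T sum_distrib_left sum_distrib_right vec_lambda_beta
    by (subst sum.swap) (simp add: mult.assoc)
  then show ?thesis unfolding rank_le_iff
    by (intro exI[of _ "\<lambda>l i. \<Sum>p\<in>UNIV. g $ i $ p * u l p"] exI[of _ v] exI[of _ w]) blast
qed

lemma tendsto_change_basis:
  fixes T :: "complex^'n^'m^'p"
  assumes "(X \<longlongrightarrow> T) F"
  shows "((\<lambda>x. change_basis g (X x)) \<longlongrightarrow> change_basis g T) F"
  unfolding change_basis_def
  by (rule tendsto_vec_lambda, rule tendsto_vec_lambda, rule tendsto_vec_lambda, rule tendsto_sum,
      rule tendsto_mult[OF tendsto_const], rule tendsto_vec_nth, rule tendsto_vec_nth,
      rule tendsto_vec_nth, rule assms)

lemma span_range_iff: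
  fixes M :: "'i::finite \<Rightarrow> 'a::field^'n^'m"
  assumes "inj M"
  shows "A \<in> matsp.span (range M) \<longleftrightarrow> (\<exists>c. A = (\<Sum>i\<in>UNIV. mat_scale (c i) (M i)))"
proof
  assume "A \<in> matsp.span (range M)"
  then obtain u where "A = (\<Sum>v\<in>range M. mat_scale (u v) v)"
    by (auto simp: matsp.span_finite)
  then show "\<exists>c. A = (\<Sum>i\<in>UNIV. mat_scale (c i) (M i))"
    by (intro exI[of _ "\<lambda>i. u (M i)"]) (simp add: sum.reindex[OF assms])
next
  assume "\<exists>c. A = (\<Sum>i\<in>UNIV. mat_scale (c i) (M i))"
  then show "A \<in> matsp.span (range M)"
    by (auto intro!: matsp.span_sum matsp.span_scale intro: matsp.span_base)
qed

lemma pattern_linear: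
  "pattern p q s t a b d e = mat_scale a (pattern p q s t 1 0 0 0) +
     mat_scale b (pattern p q s t 0 1 0 0) + mat_scale d (pattern p q s t 0 0 1 0) +
     mat_scale e (pattern p q s t 0 0 0 1)"
  by (simp add: vec_eq_iff forall_5 pattern_def mat_scale_def algebra_simps)

lemma mem_with_identity_pattern:
  assumes "A \<in> with_identity {pattern p q s t a b d e | a b d e. True}"
  shows "\<exists>c. A = (\<Sum>i\<in>UNIV. mat_scale (c $ i) (pattern_tensor p q s t $ i))"
proof -
  let ?f = "\<lambda>c. \<Sum>i\<in>UNIV. mat_scale (c $ i) (pattern_tensor p q s t $ i)"
  have add: "?f (x + y) = ?f x + ?f y" and scale: "?f (k *s x) = mat_scale k (?f x)" for x y k
    by (simp_all add: sum.distrib matsp.scale_left_distrib matsp.scale_sum_right)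
  have "matsp.subspace (range ?f)"
    unfolding matsp.subspace_def
  proof safe
    show "0 \<in> range ?f" by (rule range_eqI[of _ _ 0]) simp
    show "?f x + ?f y \<in> range ?f" for x y by (rule range_eqI[of _ _ "x + y"]) (rule add[symmetric])
    show "mat_scale k (?f x) \<in> range ?f" for k x
      by (rule range_eqI[of _ _ "k *s x"]) (rule scale[symmetric])
  qed
  moreover have "mat 1 = ?f (vector [1, 0, 0, 0, 0])"
    by (simp add: sum_5 pattern_tensor_def)
  moreover have "pattern p q s t a b d e = ?f (vector [0, a, b, d, e])" for a b d e
    by (subst pattern_linear) (simp add: sum_5 pattern_tensor_def)
  ultimately have "matsp.span (insert (mat 1) {pattern p q s t a b d e | a b d e. True}) \<subseteq> range ?f"
    by (intro matsp.span_minimal) auto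
  then show ?thesis using assms unfolding with_identity_def by blast
qed

lemma pattern_tensor_mem_with_identity:
  "pattern_tensor p q s t $ i \<in> with_identity {pattern p q s t a b d e | a b d e. True}"
proof -
  have "pattern p q s t a b d e \<in> {pattern p q s t a b d e | a b d e. True}" for a b d e
    by blast
  then have "pattern_tensor p q s t $ i \<in> insert (mat 1) {pattern p q s t a b d e | a b d e. True}"
    using exhaust_5[of i] by (elim disjE) (simp_all only: pattern_tensor_def vector_5 insert_iff simp_thms)
  then show ?thesis unfolding with_identity_def by (rule matsp.span_base)
qed

text \<open>Rank bounds and limits pass through \<open>change_basis\<close>, so maps in both
  directions let one representative decide rank and border rank for all tensors of the
  space.\<close>

lemma space_tensors_change_basis:
  fixes T :: "complex^5^5^5"
  assumes "T \<in> space_tensors (with_identity {pattern p q s t a b d e | a b d e. True})"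
  obtains g h where "T = change_basis g (pattern_tensor p q s t)" "pattern_tensor p q s t = change_basis h T"
proof -
  let ?U = "with_identity {pattern p q s t a b d e | a b d e. True}"
  obtain a :: "5 \<Rightarrow> complex^5" and M where T: "T = (\<Sum>i\<in>UNIV. tensor_mat (a i) (M i))"
    and a: "inj a" "vec.span (range a) = UNIV"
    and M: "inj M" "matsp.span (range M) = ?U"
    using assms unfolding space_tensors_def mem_Collect_eq by (elim exE conjE) (rule that)
  have "M m \<in> ?U" for m
    unfolding M(2)[symmetric] by (rule matsp.span_base) simp
  then have "\<forall>m. \<exists>c. M m = (\<Sum>i\<in>UNIV. mat_scale (c $ i) (pattern_tensor p q s t $ i))"
    by (intro allI mem_with_identity_pattern)
  then obtain c where c: "\<And>m. M m = (\<Sum>i\<in>UNIV. mat_scale (c m $ i) (pattern_tensor p q s t $ i))"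
    unfolding choice_iff by (elim exE) (rule that, erule spec)
  have "\<forall>i. \<exists>d. pattern_tensor p q s t $ i = (\<Sum>m\<in>UNIV. mat_scale (d m) (M m))"
    unfolding span_range_iff[OF M(1), symmetric] M(2) by (intro allI pattern_tensor_mem_with_identity)
  then obtain d where d: "\<And>i. pattern_tensor p q s t $ i = (\<Sum>m\<in>UNIV. mat_scale (d i m) (M m))"
    unfolding choice_iff by (elim exE) (rule that, erule spec)
  have "\<forall>n. \<exists>e. axis n 1 = (\<Sum>m\<in>UNIV. e m *s a m)"
  proof
    fix n
    have "(axis n 1 :: complex^5) \<in> vec.span (range a)"
      unfolding a(2) by (rule UNIV_I)
    then obtain u where "axis n 1 = (\<Sum>v\<in>range a. u v *s v)"
      unfolding vec.span_finite[OF finite_imageI[OF finite]] by (elim imageE) (rule that)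
    then show "\<exists>e. axis n 1 = (\<Sum>m\<in>UNIV. e m *s a m)"
      by (intro exI[of _ "\<lambda>i. u (a i)"]) (simp add: sum.reindex[OF a(1)])
  qed
  then obtain e where e: "\<And>n. axis n 1 = (\<Sum>m\<in>UNIV. e n m *s a m)"
    unfolding choice_iff by (elim exE) (rule that, erule spec)
  \<comment> \<open>A left inverse of a square matrix is a right inverse. Hence column
    \<open>m\<close> of \<open>e\<close> is the functional dual to \<open>a m\<close>, and
    contracting \<open>T\<close> with it recovers \<open>M m\<close>.\<close>
  have "(\<chi> n m. e n m) ** (\<chi> m i. a m $ i) = mat 1"
    unfolding vec_eq_iff
  proof (intro allI)
    fix n i
    have "(axis n 1 :: complex^5) $ i = (\<Sum>m\<in>UNIV. e n m *s a m) $ i" using e by simp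
    then show "((\<chi> n m. e n m) ** (\<chi> m i. a m $ i)) $ n $ i = (mat 1 :: complex^5^5) $ n $ i"
      by (auto simp: matrix_matrix_mult_def mat_def axis_def)
  qed
  then have "(\<chi> m i. a m $ i) ** (\<chi> n m. e n m) = mat 1"
    by (simp add: matrix_left_right_inverse)
  then have ae: "(\<Sum>i\<in>UNIV. a m $ i * e i n) = (if m = n then 1 else 0)" for m n
    by (simp add: matrix_matrix_mult_def mat_def vec_eq_iff)
  have T': "T $ i $ j $ k = (\<Sum>m\<in>UNIV. a m $ i * M m $ j $ k)" for i j k
    by (simp add: T tensor_mat_def)
  have T_eq: "T = change_basis (\<chi> i p. \<Sum>m\<in>UNIV. a m $ i * c m $ p) (pattern_tensor p q s t)"
    unfolding vec_eq_iff change_basis_def T' c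
    by (simp add: mat_scale_def sum_distrib_left sum_distrib_right mult.assoc)
      (subst sum.swap, simp)
  have M': "M m $ j $ k = (\<Sum>i\<in>UNIV. e i m * T $ i $ j $ k)" for m j k
  proof -
    have "(\<Sum>i\<in>UNIV. e i m * T $ i $ j $ k) = (\<Sum>n\<in>UNIV. (\<Sum>i\<in>UNIV. a n $ i * e i m) * M n $ j $ k)"
      unfolding T' sum_distrib_left sum_distrib_right
      by (subst sum.swap) (simp add: mult_ac)
    then show ?thesis by (simp add: ae mult_delta_left)
  qed
  have base_eq: "pattern_tensor p q s t = change_basis (\<chi> p i. \<Sum>m\<in>UNIV. d p m * e i m) T"
    unfolding vec_eq_iff change_basis_def d
    by (simp add: mat_scale_def M' sum_distrib_left sum_distrib_right mult.assoc)
      (subst sum.swap, simp)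
  show thesis by (rule that[OF T_eq base_eq])
qed

section \<open>Border rank and invertible combinations of slices\<close>

text \<open>Every combination of slices has its image in the span of the \<open>r\<close> vectors
  \<open>v l\<close>; an invertible one makes them span the whole space.\<close>

lemma rank_le_slice_combination_det:
  fixes T :: "'a::field^'n^'n^'i"
  assumes "rank_le r T" "det (\<chi> j k. \<Sum>i\<in>UNIV. h $ i * T $ i $ j $ k) \<noteq> 0"
  shows "CARD('n) \<le> r"
proof -
  let ?Y = "(\<chi> j k. \<Sum>i\<in>UNIV. h $ i * T $ i $ j $ k) :: 'a^'n^'n"
  obtain u v w where T: "\<And>i j k. T $ i $ j $ k = (\<Sum>l<r. u l i * v l j * w l k)"
    using assms(1) unfolding rank_le_iff by blast
  obtain Z where Z: "?Y ** Z = mat 1"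
    using assms(2) unfolding invertible_det_nz[symmetric] invertible_def by blast
  have Y: "?Y *v z = (\<Sum>l<r. (\<Sum>k\<in>UNIV. \<Sum>i\<in>UNIV. h $ i * u l i * w l k * z $ k) *s (\<chi> j. v l j))" for z
    unfolding vec_eq_iff
  proof
    fix j
    have "(?Y *v z) $ j = (\<Sum>k\<in>UNIV. \<Sum>i\<in>UNIV. \<Sum>l<r. h $ i * u l i * v l j * w l k * z $ k)"
      by (simp add: matrix_vector_mult_def T sum_distrib_left sum_distrib_right mult.assoc)
    also have "\<dots> = (\<Sum>l<r. \<Sum>k\<in>UNIV. \<Sum>i\<in>UNIV. h $ i * u l i * v l j * w l k * z $ k)"
      by (simp only: sum.swap[of _ "{..<r}" UNIV])
    finally show "(?Y *v z) $ j =
      (\<Sum>l<r. (\<Sum>k\<in>UNIV. \<Sum>i\<in>UNIV. h $ i * u l i * w l k * z $ k) *s (\<chi> j. v l j)) $ j"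
      by (simp add: sum_distrib_left sum_distrib_right mult_ac)
  qed
  have "z \<in> vec.span ((\<lambda>l. \<chi> j. v l j) ` {..<r})" for z
  proof -
    have "?Y *v (Z *v z) = z" by (simp add: matrix_vector_mul_assoc Z)
    moreover have "?Y *v (Z *v z) \<in> vec.span ((\<lambda>l. \<chi> j. v l j) ` {..<r})"
      unfolding Y by (intro vec.span_sum vec.span_scale vec.span_base) auto
    ultimately show ?thesis by simp
  qed
  then have "vec.dim (UNIV :: ('a^'n) set) \<le> card ((\<lambda>l. (\<chi> j. v l j) :: 'a^'n) ` {..<r})"
    by (intro vec.dim_le_card) auto
  also have "\<dots> \<le> r" using card_image_le[of "{..<r}"] by (metis card_lessThan finite_lessThan)
  finally show ?thesis by (simp add: card_cart_basis)
qed

lemma tendsto_det: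
  fixes A :: "complex^'n^'n"
  assumes "(X \<longlongrightarrow> A) F"
  shows "((\<lambda>x. det (X x)) \<longlongrightarrow> det A) F"
  unfolding det_def
  by (rule tendsto_sum, rule tendsto_mult[OF tendsto_const], rule tendsto_prod,
      rule tendsto_vec_nth, rule tendsto_vec_nth, rule assms)

text \<open>\<open>border_rank\<close> asks for approximants of rank exactly r. Near
  \<open>T\<close> the determinant stays nonzero, which forces rank at least
  \<open>CARD('n)\<close>, so a tail of any approximating sequence from the closure has exactly this
  rank.\<close>

lemma border_rank_eqI:
  fixes T :: "complex^'n^'n^'i"
  assumes h: "det (\<chi> j k. \<Sum>i\<in>UNIV. h $ i * T $ i $ j $ k) \<noteq> 0"
    and T: "T \<in> closure {X. rank_le CARD('n) X}"
  shows "border_rank T = CARD('n)"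
proof -
  have ev: "eventually (\<lambda>n. det (\<chi> j k. \<Sum>i\<in>UNIV. h $ i * X n $ i $ j $ k) \<noteq> 0) sequentially"
    if "X \<longlonglongrightarrow> T" for X
    by (rule tendsto_imp_eventually_ne[OF tendsto_det h], rule tendsto_vec_lambda,
        rule tendsto_vec_lambda, rule tendsto_sum, rule tendsto_mult[OF tendsto_const],
        rule tendsto_vec_nth, rule tendsto_vec_nth, rule tendsto_vec_nth, rule that)
  show ?thesis
    unfolding border_rank_def
  proof (rule Least_equality)
    obtain X where X: "\<And>n. rank_le CARD('n) (X n)" "X \<longlonglongrightarrow> T"
      using T unfolding closure_sequential by blast
    obtain N where N: "\<And>n. n \<ge> N \<Longrightarrow> det (\<chi> j k. \<Sum>i\<in>UNIV. h $ i * X n $ i $ j $ k) \<noteq> 0"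
      using ev[OF X(2)] unfolding eventually_sequentially by blast
    have "tensor_rank (X (n + N)) = CARD('n)" for n
      using rank_le_slice_combination_det[OF _ N[OF le_add2]] by (rule tensor_rank_eqI[OF X(1)])
    then show "\<exists>X. (\<forall>n. tensor_rank (X n) = CARD('n)) \<and> X \<longlonglongrightarrow> T"
      using LIMSEQ_ignore_initial_segment[OF X(2), of N]
      by (intro exI[of _ "\<lambda>n. X (n + N)"] conjI allI)
  next
    fix r assume "\<exists>X. (\<forall>n. tensor_rank (X n) = r) \<and> X \<longlonglongrightarrow> T"
    then obtain X where X: "\<And>n. tensor_rank (X n) = r" "X \<longlonglongrightarrow> T" by blast
    obtain n where n: "det (\<chi> j k. \<Sum>i\<in>UNIV. h $ i * X n $ i $ j $ k) \<noteq> 0"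
      using eventually_happens'[OF sequentially_bot ev[OF X(2)]] by blast
    have "rank_le r (X n)"
      using rank_le_tensor_rank[of "X n"] unfolding X(1) .
    then show "CARD('n) \<le> r"
      using n by (rule rank_le_slice_combination_det)
  qed
qed

lemma space_tensors_ranks:
  fixes T :: "complex^5^5^5"
  assumes T: "T \<in> space_tensors (with_identity {pattern p q s t a b d e | a b d e. True})"
    and upper: "rank_le r (pattern_tensor p q s t)" and lower: "\<And>k. rank_le k (pattern_tensor p q s t) \<Longrightarrow> r \<le> k"
    and border: "pattern_tensor p q s t \<in> closure {X. rank_le 5 X}"
  shows "border_rank T = 5 \<and> tensor_rank T = r"
proof
  obtain g h where gh: "T = change_basis g (pattern_tensor p q s t)" "pattern_tensor p q s t = change_basis h T"
    using space_tensors_change_basis[OF T] .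
  show "tensor_rank T = r"
  proof (rule tensor_rank_eqI)
    show "rank_le r T"
      unfolding gh(1) by (rule rank_le_change_basis[OF upper])
    show "r \<le> k" if "rank_le k T" for k
      by (rule lower, subst gh(2), rule rank_le_change_basis[OF that])
  qed
  \<comment> \<open>Row 1 of \<open>h\<close> expresses the identity slice through the slices of
    \<open>T\<close>.\<close>
  have "(\<chi> j k. \<Sum>i\<in>UNIV. h $ 1 $ i * T $ i $ j $ k) = change_basis h T $ 1"
    by (simp add: change_basis_def vec_eq_iff)
  also have "\<dots> = mat 1" by (simp flip: gh(2)) (simp add: pattern_tensor_def)
  finally have "det (\<chi> j k. \<Sum>i\<in>UNIV. h $ 1 $ i * T $ i $ j $ k) \<noteq> 0" by simp
  moreover have "T \<in> closure {X. rank_le CARD(5) X}"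
  proof -
    obtain X where "\<And>n. rank_le 5 (X n)" "X \<longlonglongrightarrow> pattern_tensor p q s t"
      using border unfolding closure_sequential by blast
    then show ?thesis
      unfolding closure_sequential gh(1)
      by (intro exI[of _ "\<lambda>n. change_basis g (X n)"])
        (simp add: rank_le_change_basis tendsto_change_basis)
  qed
  ultimately show "border_rank T = 5" using border_rank_eqI[of "h $ 1" T] by simp
qed

section \<open>Explicit decompositions for the rank\<close>

lemma rank_le_sum_listI:
  assumes "T = (\<Sum>(u, v, w)\<leftarrow>xs. tensor3 u v w)" "length xs = r"
  shows "rank_le r T"
  using assms
proof (induction xs arbitrary: r T)
  case Nil
  then show ?case by (simp add: rank_le_0)
next
  case (Cons x xs)
  obtain u v w where x: "x = (u, v, w)" by (cases x)
  show ?case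
    using rank_le_Suc[OF Cons.IH[OF refl refl], of u v w] Cons.prems by (simp add: x add.commute)
qed

lemmas tensor5_expand = vec_eq_iff forall_5 list.map sum_list.Cons sum_list.Nil split vector_5
  vector_add_component tensor3_def vec_lambda_beta vector_smult_component zero_index

lemma rank_le_pattern_tensor_S1: "rank_le 9 (pattern_tensor 0 0 1 0)"
proof -
  \<comment> \<open>On coordinates 1, 3, 5 the matrix N + E_35 has eigenvalues 0, 1, -1; its
    eigenprojections are the first three terms, and the fourth subtracts E_35 again. Coordinates 2
    and 4 need one diagonal term each, and \<open>d\<close>, \<open>b\<close>, \<open>e\<close> one
    term each.\<close>
  define xs :: "((complex^5) \<times> (complex^5) \<times> (complex^5)) list" where "xs =
    [(vector [1, 0, 0, 0, 0], vector [1, 0, 0, 0, - 1], vector [1, 0, 0, 0, 0]),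
     (vector [1/2, 1/2, 0, 0, 0], vector [0, 0, 1, 0, 1], vector [1, 0, 1, 0, 1]),
     (vector [1/2, - 1/2, 0, 0, 0], vector [0, 0, 1, 0, - 1], vector [- 1, 0, 1, 0, - 1]),
     (vector [0, - 1, 0, 0, 0], vector [0, 0, 1, 0, 0], vector [0, 0, 0, 0, 1]),
     (vector [1, 0, 0, 0, 0], vector [0, 1, 0, 0, 0], vector [0, 1, 0, 0, 0]),
     (vector [1, 0, 0, 0, 0], vector [0, 0, 0, 1, 0], vector [0, 0, 0, 1, 0]),
     (vector [0, 0, 0, 1, 0], vector [0, 0, 0, 1, 0], vector [1, 0, 0, 0, 0]),
     (vector [0, 0, 1, 0, 0], vector [0, 0, 0, 0, 1], vector [1, 0, 0, 0, 0]),
     (vector [0, 0, 0, 0, 1], vector [0, 0, 0, 0, 1], vector [0, 1, 0, 0, 0])]"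
  have "pattern_tensor 0 0 1 0 = (\<Sum>(u, v, w)\<leftarrow>xs. tensor3 u v w)"
    unfolding xs_def pattern_tensor_def pattern_def tensor5_expand by (simp add: mat_def)
  then show ?thesis by (rule rank_le_sum_listI) (simp add: xs_def)
qed

lemma rank_le_pattern_tensor_S2: "rank_le 10 (pattern_tensor 1 0 1 0)"
proof -
  \<comment> \<open>N now has a second Jordan block, on coordinates 2 and 4. Adding E_24 gives it
    the eigenvalues 1 and -1, and subtracting E_24 again is the additional tenth term.\<close>
  define xs :: "((complex^5) \<times> (complex^5) \<times> (complex^5)) list" where "xs =
    [(vector [1, 0, 0, 0, 0], vector [1, 0, 0, 0, - 1], vector [1, 0, 0, 0, 0]),
     (vector [1/2, 1/2, 0, 0, 0], vector [0, 0, 1, 0, 1], vector [1, 0, 1, 0, 1]),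
     (vector [1/2, - 1/2, 0, 0, 0], vector [0, 0, 1, 0, - 1], vector [- 1, 0, 1, 0, - 1]),
     (vector [0, - 1, 0, 0, 0], vector [0, 0, 1, 0, 0], vector [0, 0, 0, 0, 1]),
     (vector [1/2, 1/2, 0, 0, 0], vector [0, 1, 0, 1, 0], vector [0, 1, 0, 1, 0]),
     (vector [1/2, - 1/2, 0, 0, 0], vector [0, 1, 0, - 1, 0], vector [0, 1, 0, - 1, 0]),
     (vector [0, - 1, 0, 0, 0], vector [0, 1, 0, 0, 0], vector [0, 0, 0, 1, 0]),
     (vector [0, 0, 0, 1, 0], vector [0, 0, 0, 1, 0], vector [1, 0, 0, 0, 0]),
     (vector [0, 0, 1, 0, 0], vector [0, 0, 0, 0, 1], vector [1, 0, 0, 0, 0]),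
     (vector [0, 0, 0, 0, 1], vector [0, 0, 0, 0, 1], vector [0, 1, 0, 0, 0])]"
  have "pattern_tensor 1 0 1 0 = (\<Sum>(u, v, w)\<leftarrow>xs. tensor3 u v w)"
    unfolding xs_def pattern_tensor_def pattern_def tensor5_expand by (simp add: mat_def)
  then show ?thesis by (rule rank_le_sum_listI) (simp add: xs_def)
qed

lemma rank_le_pattern_tensor_S3: "rank_le 9 (pattern_tensor 0 1 0 0)"
proof -
  define xs :: "((complex^5) \<times> (complex^5) \<times> (complex^5)) list" where "xs =
    [(vector [1, 0, 0, 0, 0], vector [1, 0, 0, 0, - 1], vector [1, 0, 0, 0, 0]),
     (vector [1/2, 1/2, 0, 0, 0], vector [0, 0, 1, 0, 1], vector [1, 0, 1, 0, 1]),
     (vector [1/2, - 1/2, 0, 0, 0], vector [0, 0, 1, 0, - 1], vector [- 1, 0, 1, 0, - 1]),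
     (vector [0, - 1, 0, 0, 0], vector [0, 0, 1, 0, 0], vector [0, 0, 0, 0, 1]),
     (vector [1, 0, 0, 0, 0], vector [0, 1, 0, 0, 0], vector [0, 1, 0, 0, 0]),
     (vector [1, 0, 0, 0, 0], vector [0, 0, 0, 1, 0], vector [0, 0, 0, 1, 0]),
     (vector [0, 0, 0, 1, 0], vector [0, 0, 0, 1, 0], vector [1, 0, 0, 0, 0]),
     (vector [0, 0, 1, 0, 0], vector [0, 0, 0, 0, 1], vector [1, 0, 0, 0, 0]),
     (vector [0, 0, 0, 0, 1], vector [0, 0, 0, 1, 0], vector [0, 1, 0, 0, 0])]"
  have "pattern_tensor 0 1 0 0 = (\<Sum>(u, v, w)\<leftarrow>xs. tensor3 u v w)"
    unfolding xs_def pattern_tensor_def pattern_def tensor5_expand by (simp add: mat_def)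
  then show ?thesis by (rule rank_le_sum_listI) (simp add: xs_def)
qed

lemma rank_le_pattern_tensor_S4: "rank_le 9 (pattern_tensor 0 1 0 1)"
proof -
  \<comment> \<open>The coefficient D = E_41 + E_52 of \<open>d\<close> has rank 2, but it is (e_4 +
    e_5)(e_1 + e_2)^T - E_51 - E_42. The last two matrices are those of \<open>b\<close> and
    \<open>e\<close>, whose terms absorb the corrections.\<close>
  define xs :: "((complex^5) \<times> (complex^5) \<times> (complex^5)) list" where "xs =
    [(vector [1, 0, 0, 0, 0], vector [1, 0, 0, 0, - 1], vector [1, 0, 0, 0, 0]),
     (vector [1/2, 1/2, 0, 0, 0], vector [0, 0, 1, 0, 1], vector [1, 0, 1, 0, 1]),
     (vector [1/2, - 1/2, 0, 0, 0], vector [0, 0, 1, 0, - 1], vector [- 1, 0, 1, 0, - 1]),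
     (vector [0, - 1, 0, 0, 0], vector [0, 0, 1, 0, 0], vector [0, 0, 0, 0, 1]),
     (vector [1, 0, 0, 0, 0], vector [0, 1, 0, 0, 0], vector [0, 1, 0, 0, 0]),
     (vector [1, 0, 0, 0, 0], vector [0, 0, 0, 1, 0], vector [0, 0, 0, 1, 0]),
     (vector [0, 0, 0, 1, 0], vector [0, 0, 0, 1, 1], vector [1, 1, 0, 0, 0]),
     (vector [0, 0, 1, - 1, 0], vector [0, 0, 0, 0, 1], vector [1, 0, 0, 0, 0]),
     (vector [0, 0, 0, - 1, 1], vector [0, 0, 0, 1, 0], vector [0, 1, 0, 0, 0])]"
  have "pattern_tensor 0 1 0 1 = (\<Sum>(u, v, w)\<leftarrow>xs. tensor3 u v w)"
    unfolding xs_def pattern_tensor_def pattern_def tensor5_expand by (simp add: mat_def)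
  then show ?thesis by (rule rank_le_sum_listI) (simp add: xs_def)
qed

section \<open>Approximation by tensors with five terms\<close>

lemma tendsto_vector5:
  fixes a :: "'a::{zero,topological_space}"
  assumes "(f1 \<longlongrightarrow> a) F" "(f2 \<longlongrightarrow> b) F" "(f3 \<longlongrightarrow> c) F" "(f4 \<longlongrightarrow> d) F" "(f5 \<longlongrightarrow> e) F"
  shows "((\<lambda>x. vector [f1 x, f2 x, f3 x, f4 x, f5 x] :: 'a^5) \<longlongrightarrow> vector [a, b, c, d, e]) F"
proof (rule vec_tendstoI)
  fix i :: 5
  show "((\<lambda>x. (vector [f1 x, f2 x, f3 x, f4 x, f5 x] :: 'a^5) $ i) \<longlongrightarrow> vector [a, b, c, d, e] $ i) F"
    using exhaust_5[of i] assms by (elim disjE) simp_all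
qed

text \<open>The filter \<open>at 0\<close> leaves out 0 itself, where the decompositions below
  divide by \<open>t\<close>.\<close>

lemma closure_rank_leI:
  fixes X :: "complex \<Rightarrow> complex^'n^'m^'i"
  assumes "\<And>t. t \<noteq> 0 \<Longrightarrow> rank_le r (X t)" "(X \<longlongrightarrow> T) (at 0)"
  shows "T \<in> closure {X. rank_le r X}"
proof (rule Lim_in_closed_set[OF closed_closure _ _ assms(2)])
  have "X t \<in> closure {X. rank_le r X}" if "t \<noteq> 0" for t
    using assms(1)[OF that] closure_subset by blast
  then show "eventually (\<lambda>t. X t \<in> closure {X. rank_le r X}) (at 0)"
    by (simp add: eventually_at_filter)
qed simp

lemma pattern_tensor_closure_S1: "pattern_tensor 0 0 1 0 \<in> closure {X. rank_le 5 X}"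
proof (rule closure_rank_leI)
  \<comment> \<open>Slice 3 is the square of slice 2, whose row 3 is chosen to annihilate the
    columns (t,0,0,1,0) and (0,t,0,0,1) of slices 4 and 5. In each term below, \<open>v\<close> is a
    common eigenvector of all slices, \<open>w\<close> the dual row up to scaling, and
    \<open>u\<close> lists the five eigenvalues, scaled to normalize the projection.\<close>
  let ?X = "\<lambda>t. vector [mat 1,
    vector [vector [0, 0, 0, 0, 0], vector [0, 0, 0, 0, 0], vector [1, - t, 0, - t, t^2],
      vector [0, 0, 0, 0, 0], vector [0, 0, 1, 0, 0]],
    vector [vector [0, 0, 0, 0, 0], vector [0, 0, 0, 0, 0], vector [0, 0, t^2, 0, 0],
      vector [0, 0, 0, 0, 0], vector [1, - t, 0, - t, t^2]],
    vector [vector [t, 0, 0, 0, 0], vector [0, 0, 0, 0, 0], vector [0, 0, 0, 0, 0],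
      vector [1, 0, 0, 0, 0], vector [0, 0, 0, 0, 0]],
    vector [vector [0, 0, 0, 0, 0], vector [0, t, 0, 0, 0], vector [0, 0, 0, 0, 0],
      vector [0, 0, 0, 0, 0], vector [0, 1, 0, 0, 0]]] :: complex^5^5^5"
  show "(?X \<longlongrightarrow> pattern_tensor 0 0 1 0) (at 0)"
    unfolding pattern_tensor_def pattern_def
    by (intro tendsto_vector5, simp_all only: mult_zero_left mult_zero_right mult_1_right
        mult_1_left add_0_left add_0_right tendsto_const)
      (rule tendsto_eq_intros refl | simp)+
  fix t :: complex assume t: "t \<noteq> 0"
  \<comment> \<open>The first three terms are the eigenprojections of the second slice
    for the eigenvalues \<open>t\<close>, \<open>-t\<close>, \<open>0\<close>.\<close>
  define xs :: "((complex^5) \<times> (complex^5) \<times> (complex^5)) list" where "xs =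
    [((1/(2*t^2)) *s vector [1, t, t^2, 0, 0],
      vector [0, 0, t, 0, 1], vector [1, - t, t, - t, t^2]),
     ((1/(2*t^2)) *s vector [1, - t, t^2, 0, 0],
      vector [0, 0, - t, 0, 1], vector [1, - t, - t, - t, t^2]),
     ((- 1/t^2) *s vector [1, 0, 0, 0, 0],
      vector [0, 0, 0, t, 1], vector [1, 0, 0, - t, 0]),
     ((1/t) *s vector [1, 0, 0, t, 0],
      vector [t, 0, 0, 1, 0], vector [1, 0, 0, 0, 0]),
     ((1/t) *s vector [1, 0, 0, 0, t],
      vector [0, t, 0, 0, 1], vector [0, 1, 0, 0, 0])]"
  have "?X t = (\<Sum>(u, v, w)\<leftarrow>xs. tensor3 u v w)"
    using t unfolding xs_def tensor5_expand
    by (intro conjI, simp_all add: mat_def, (simp_all add: divide_simps)?,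
        (simp_all add: algebra_simps power2_eq_square power3_eq_cube)?)
  then show "rank_le 5 (?X t)" by (rule rank_le_sum_listI) (simp add: xs_def)
qed

lemma pattern_tensor_closure_S2: "pattern_tensor 1 0 1 0 \<in> closure {X. rank_le 5 X}"
proof (rule closure_rank_leI)
  \<comment> \<open>The 6 and 7 come from (z - t)(z - 2t)(z + 3t) = z^3 - 7t^2 z + 6t^3, the
    characteristic polynomial of the block of slice 2 on coordinates 3, 4, 5. The roots sum to 0
    because that block has zero diagonal.\<close>
  let ?X = "\<lambda>t. vector [mat 1,
    vector [vector [0, 0, 0, 0, 0], vector [0, 0, 0, 0, 0], vector [1, - (7*t), 0, 6*t^2, 7*t^2],
      vector [0, 1, 0, 0, - t], vector [0, 0, 1, 0, 0]],
    vector [vector [0, 0, 0, 0, 0], vector [0, 0, 0, 0, 0], vector [0, 6*t^2, 7*t^2, 0, - (6*t^3)],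
      vector [0, 0, - t, 0, 0], vector [1, - (7*t), 0, 6*t^2, 7*t^2]],
    vector [vector [- (6*t^2), 0, 0, 0, 0], vector [0, 0, 0, 0, 0], vector [0, 0, 0, 0, 0],
      vector [1, 0, 0, 0, 0], vector [0, 0, 0, 0, 0]],
    vector [vector [0, 0, 0, 0, 0], vector [0, t, 0, 0, 0], vector [0, 0, 0, 0, 0],
      vector [0, 0, 0, 0, 0], vector [0, 1, 0, 0, 0]]] :: complex^5^5^5"
  show "(?X \<longlongrightarrow> pattern_tensor 1 0 1 0) (at 0)"
    unfolding pattern_tensor_def pattern_def
    by (intro tendsto_vector5, simp_all only: mult_zero_left mult_zero_right mult_1_right
        mult_1_left add_0_left add_0_right tendsto_const)
      (rule tendsto_eq_intros refl | simp)+
  fix t :: complex assume t: "t \<noteq> 0"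
  \<comment> \<open>Here the eigenvalues are \<open>t\<close>, \<open>2t\<close>, \<open>-3t\<close>.\<close>
  define xs :: "((complex^5) \<times> (complex^5) \<times> (complex^5)) list" where "xs =
    [((1/(- (4*t^2))) *s vector [1, t, t^2, 0, 0],
      vector [0, 0, t, - 1, 1], vector [1, - t, t, 6*t^2, t^2]),
     ((1/(10*t^2)) *s vector [1, 2*t, 4*t^2, 0, 0],
      vector [0, 0, 4*t, - 1, 2], vector [1, - (4*t), 2*t, 6*t^2, 4*t^2]),
     ((1/(- (60*t^2))) *s vector [1, - (3*t), 9*t^2, 0, 0],
      vector [0, 0, 9*t, - 1, - 3], vector [1, - (9*t), - (3*t), 6*t^2, 9*t^2]),
     ((- 1/(6*t^2)) *s vector [1, 0, 0, - (6*t^2), 0],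
      vector [- (6*t^2), 0, 0, 1, 0], vector [1, 0, 0, 0, 0]),
     ((1/t) *s vector [1, 0, 0, 0, t],
      vector [0, t, 0, 0, 1], vector [0, 1, 0, 0, 0])]"
  have "?X t = (\<Sum>(u, v, w)\<leftarrow>xs. tensor3 u v w)"
    using t unfolding xs_def tensor5_expand
    by (intro conjI, simp_all add: mat_def, (simp_all add: divide_simps)?,
        (simp_all add: algebra_simps power2_eq_square power3_eq_cube)?)
  then show "rank_le 5 (?X t)" by (rule rank_le_sum_listI) (simp add: xs_def)
qed

lemma pattern_tensor_closure_S3: "pattern_tensor 0 1 0 0 \<in> closure {X. rank_le 5 X}"
proof (rule closure_rank_leI)
  \<comment> \<open>Both idempotents now use coordinate 4, so entry (3,4) of slice 2 must cancel two
    contributions in row 3. Taking it as -t^2 makes entry (3,2) equal to \<open>t\<close>, which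
    still tends to 0, and puts t^2 at (1,1) in slice 4.\<close>
  let ?X = "\<lambda>t. vector [mat 1,
    vector [vector [0, 0, 0, 0, 0], vector [0, 0, 0, 0, 0], vector [1, t, 0, - (t^2), t^2],
      vector [0, 0, 0, 0, 0], vector [0, 0, 1, 0, 0]],
    vector [vector [0, 0, 0, 0, 0], vector [0, 0, 0, 0, 0], vector [0, 0, t^2, 0, 0],
      vector [0, 0, 0, 0, 0], vector [1, t, 0, - (t^2), t^2]],
    vector [vector [t^2, 0, 0, 0, 0], vector [0, 0, 0, 0, 0], vector [0, 0, 0, 0, 0],
      vector [1, 0, 0, 0, 0], vector [0, 0, 0, 0, 0]],
    vector [vector [0, 0, 0, 0, 0], vector [0, t, 0, 0, 0], vector [0, 0, 0, 0, 0],
      vector [0, 1, 0, 0, 0], vector [0, 0, 0, 0, 0]]] :: complex^5^5^5"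
  show "(?X \<longlongrightarrow> pattern_tensor 0 1 0 0) (at 0)"
    unfolding pattern_tensor_def pattern_def
    by (intro tendsto_vector5, simp_all only: mult_zero_left mult_zero_right mult_1_right
        mult_1_left add_0_left add_0_right tendsto_const)
      (rule tendsto_eq_intros refl | simp)+
  fix t :: complex assume t: "t \<noteq> 0"
  define xs :: "((complex^5) \<times> (complex^5) \<times> (complex^5)) list" where "xs =
    [((1/(2*t^2)) *s vector [1, t, t^2, 0, 0],
      vector [0, 0, t, 0, 1], vector [1, t, t, - (t^2), t^2]),
     ((1/(2*t^2)) *s vector [1, - t, t^2, 0, 0],
      vector [0, 0, - t, 0, 1], vector [1, t, - t, - (t^2), t^2]),
     ((- 1/t^2) *s vector [1, 0, 0, 0, 0],
      vector [0, 0, 0, 1, 1], vector [1, t, 0, - (t^2), 0]),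
     ((1/t^2) *s vector [1, 0, 0, t^2, 0],
      vector [t^2, 0, 0, 1, 0], vector [1, 0, 0, 0, 0]),
     ((1/t) *s vector [1, 0, 0, 0, t],
      vector [0, t, 0, 1, 0], vector [0, 1, 0, 0, 0])]"
  have "?X t = (\<Sum>(u, v, w)\<leftarrow>xs. tensor3 u v w)"
    using t unfolding xs_def tensor5_expand
    by (intro conjI, simp_all add: mat_def, (simp_all add: divide_simps)?,
        (simp_all add: algebra_simps power2_eq_square power3_eq_cube)?)
  then show "rank_le 5 (?X t)" by (rule rank_le_sum_listI) (simp add: xs_def)
qed

lemma pattern_tensor_closure_S4: "pattern_tensor 0 1 0 1 \<in> closure {X. rank_le 5 X}"
proof (rule closure_rank_leI)
  \<comment> \<open>With v = (t^2,0,0,1,1) and w = (1,1,0,0,0), slice 4 is v w^T minus slice 5 minus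
    slice 3, a deformation of D = (e_4 + e_5)(e_1 + e_2)^T - E_42 - E_51. Hence its eigenvalue is
    -t^2 on the eigenvectors of slice 2 for t and -t.\<close>
  let ?X = "\<lambda>t. vector [mat 1,
    vector [vector [0, 0, 0, 0, 0], vector [0, 0, 0, 0, 0], vector [1, 0, 0, - (2*t^2), t^2],
      vector [0, 0, 0, 0, 0], vector [0, 0, 1, 0, 0]],
    vector [vector [0, 0, 0, 0, 0], vector [0, 0, 0, 0, 0], vector [0, 0, t^2, 0, 0],
      vector [0, 0, 0, 0, 0], vector [1, 0, 0, - (2*t^2), t^2]],
    vector [vector [t^2, - (t^2), 0, 0, 0], vector [0, 2*t^2, 0, 0, 0], vector [0, 0, - (t^2), 0, 0],
      vector [1, 0, 0, 0, 0], vector [0, 1, 0, 2*t^2, - (t^2)]],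
    vector [vector [0, 2*t^2, 0, 0, 0], vector [0, - (2*t^2), 0, 0, 0], vector [0, 0, 0, 0, 0],
      vector [0, 1, 0, 0, 0], vector [0, 0, 0, 0, 0]]] :: complex^5^5^5"
  show "(?X \<longlongrightarrow> pattern_tensor 0 1 0 1) (at 0)"
    unfolding pattern_tensor_def pattern_def
    by (intro tendsto_vector5, simp_all only: mult_zero_left mult_zero_right mult_1_right
        mult_1_left add_0_left add_0_right tendsto_const)
      (rule tendsto_eq_intros refl | simp)+
  fix t :: complex assume t: "t \<noteq> 0"
  define xs :: "((complex^5) \<times> (complex^5) \<times> (complex^5)) list" where "xs =
    [((1/(2*t^2)) *s vector [1, t, t^2, - (t^2), 0],
      vector [0, 0, t, 0, 1], vector [1, 0, t, - (2*t^2), t^2]),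
     ((1/(2*t^2)) *s vector [1, - t, t^2, - (t^2), 0],
      vector [0, 0, - t, 0, 1], vector [1, 0, - t, - (2*t^2), t^2]),
     ((- 1/(2*t^2)) *s vector [1, 0, 0, 0, 0],
      vector [0, 0, 0, 1, 2], vector [2, 1, 0, - (2*t^2), 0]),
     ((- 1/(2*t^2)) *s vector [1, 0, 0, 2*t^2, - (2*t^2)],
      vector [2*t^2, - (2*t^2), 0, 1, 0], vector [0, 1, 0, 0, 0]),
     ((1/t^2) *s vector [1, 0, 0, t^2, 0],
      vector [t^2, 0, 0, 1, 1], vector [1, 1, 0, 0, 0])]"
  have "?X t = (\<Sum>(u, v, w)\<leftarrow>xs. tensor3 u v w)"
    using t unfolding xs_def tensor5_expand
    by (intro conjI, simp_all add: mat_def, (simp_all add: divide_simps)?,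
        (simp_all add: algebra_simps power2_eq_square power3_eq_cube)?)
  then show "rank_le 5 (?X t)" by (rule rank_le_sum_listI) (simp add: xs_def)
qed

theorem lemma6p9:
  shows "(\<forall>T :: complex^5^5^5. T \<in> space_tensors (with_identity S1) \<longrightarrow>
            border_rank T = 5 \<and> tensor_rank T = 9) \<and>
         (\<forall>T :: complex^5^5^5. T \<in> space_tensors (with_identity S2) \<longrightarrow>
            border_rank T = 5 \<and> tensor_rank T = 10) \<and>
         (\<forall>T :: complex^5^5^5. T \<in> space_tensors (with_identity S3) \<longrightarrow>
            border_rank T = 5 \<and> tensor_rank T = 9) \<and>
         (\<forall>T :: complex^5^5^5. T \<in> space_tensors (with_identity S4) \<longrightarrow>
            border_rank T = 5 \<and> tensor_rank T = 9)"
proof -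
  have S: "S1 = {pattern 0 0 1 0 a b d e | a b d e. True}"
    "S2 = {pattern 1 0 1 0 a b d e | a b d e. True}"
    "S3 = {pattern 0 1 0 0 a b d e | a b d e. True}"
    "S4 = {pattern 0 1 0 1 a b d e | a b d e. True}"
    by (simp_all add: S1_def S2_def S3_def S4_def pattern_def)
  show ?thesis
    unfolding S
    using space_tensors_ranks[OF _ rank_le_pattern_tensor_S1 rank_le_pattern_tensor_ge_9
        pattern_tensor_closure_S1]
      space_tensors_ranks[OF _ rank_le_pattern_tensor_S2 rank_le_pattern_tensor_ge_10
        pattern_tensor_closure_S2]
      space_tensors_ranks[OF _ rank_le_pattern_tensor_S3 rank_le_pattern_tensor_ge_9
        pattern_tensor_closure_S3]
      space_tensors_ranks[OF _ rank_le_pattern_tensor_S4 rank_le_pattern_tensor_ge_9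
        pattern_tensor_closure_S4]
    by simp
qed

end
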